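(* Let $n$ and $\delta$ be positive integers with $n/2 < \delta \le 2n/3$, and write $\delta = (1-\beta)n$ (so $1/3\le\beta<1/2$ and $p=2$). Then $$k_3(n,\delta) \ge g_3(\beta)\,n^3 = \tfrac12(1-2\beta)(1-\beta)\beta\, n^3 .$$ Moreover, equality $k_3(n,\delta)=g_3(\beta)n^3$ holds if and only if $(n,\beta)$ is feasible, and in that case a graph $G$ of order $n$ with minimum degree $\delta$ has exactly $g_3(\beta)n^3$ triangles if and only if $G\in\mathcal{G}(n,\beta)$.
   Context: All graphs are finite and simple. For a graph $G$, $k_r(G)$ denotes the number of $r$-cliques (complete subgraphs on $r$ vertices) of $G$. For positive integers $n,\delta$, $k_r(n,\delta)$ is the minimum of $k_r(G)$ over all graphs $G$ of order $n$ with minimum degree $\delta$. Throughout, $\delta=(1-\beta)n$ with $0<\beta<1$ (so $\beta n$ is an integer), and $p=\lceil \beta^{-1}\rceil-1$, so $1/(p+1)\le \beta<1/p$. For such $\beta$ and integers $r$, define $$g_r(\beta)=\binom{p-1}{r}\beta^{r}+\binom{p-1}{r-1}(1-(p-1)\beta)\beta^{r-1}+\frac12\binom{p-1}{r-2}(1-p\beta)(1-(p-1)\beta)\beta^{r-2},$$ where $p=\lceil\beta^{-1}\rceil-1$ and $\binom{x}{y}=0$ if $x<y$ or $y<0$. The family $\mathcal{G}(n,\beta)$ (defined only when $n$ and $(1-\beta)n$ are positive integers not both odd, $0<\beta<1$) consists of all graphs $G$ on vertex set $V$ with $|V|=n$ for which there is a partition $V=V_0\cup V_1\cup\dots\cup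 V_{p-1}$ with $|V_0|=(1-(p-1)\beta)n$ and $|V_i|=\beta n$ for $1\le i\le p-1$, such that: for $0\le i<j\le p-1$ every vertex of $V_i$ is adjacent to every vertex of $V_j$; for $1\le i\le p-1$, $V_i$ is an independent set; and $G[V_0]$ is a $(1-p\beta)n$-regular graph whose number of triangles is minimum among all $(1-p\beta)n$-regular graphs on $|V_0|$ vertices. The pair $(n,\beta)$ is called feasible if $\mathcal{G}(n,\beta)$ is defined and $G[V_0]$ is triangle-free for $G\in\mathcal{G}(n,\beta)$ (equivalently, some $(1-p\beta)n$-regular triangle-free graph on $(1-(p-1)\beta)n$ vertices exists). *)

theory Defs
  imports Complex_Main
begin

definition sgraph :: "'a set \<Rightarrow> 'a set set \<Rightarrow> bool" where
  "sgraph V E \<longleftrightarrow> finite V \<and> E \<subseteq> {e. e \<subseteq> V \<and> card e = 2}"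

definition degree :: "'a set set \<Rightarrow> 'a \<Rightarrow> nat" where
  "degree E v = card {u. {u, v} \<in> E}"

definition min_degree :: "'a set \<Rightarrow> 'a set set \<Rightarrow> nat" where
  "min_degree V E = Min (degree E ` V)"

definition regular :: "'a set \<Rightarrow> 'a set set \<Rightarrow> nat \<Rightarrow> bool" where
  "regular V E d \<longleftrightarrow> (\<forall>v\<in>V. degree E v = d)"

definition is_clique :: "'a set set \<Rightarrow> 'a set \<Rightarrow> bool" where
  "is_clique E S \<longleftrightarrow> (\<forall>x\<in>S. \<forall>y\<in>S. x \<noteq> y \<longrightarrow> {x, y} \<in> E)"

definition kcl :: "nat \<Rightarrow> 'a set \<Rightarrow> 'a set set \<Rightarrow> nat" where
  "kcl r V E = card {S. S \<subseteq> V \<and> card S = r \<and> is_clique E S}"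

definition induced :: "'a set set \<Rightarrow> 'a set \<Rightarrow> 'a set set" where
  "induced E S = {e \<in> E. e \<subseteq> S}"

text \<open>k_r(n, delta): minimum number of r-cliques over graphs of order n with minimum
degree delta (vertices taken from nat without loss of generality).\<close>
definition kmin :: "nat \<Rightarrow> nat \<Rightarrow> nat \<Rightarrow> nat" where
  "kmin r n \<delta> = Inf {kcl r V E | (V :: nat set) E.
       sgraph V E \<and> card V = n \<and> min_degree V E = \<delta>}"

definition pval :: "real \<Rightarrow> int" where
  "pval \<beta> = \<lceil>1 / \<beta>\<rceil> - 1"

definition binom :: "int \<Rightarrow> int \<Rightarrow> real" where
  "binom x y = (if y < 0 \<or> x < y then 0 else real (nat x choose nat y))"

definition gfun :: "nat \<Rightarrow> real \<Rightarrow> real" where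
  "gfun r \<beta> = (let p = pval \<beta> in
      binom (p - 1) (int r) * \<beta> ^ r
    + binom (p - 1) (int r - 1) * (1 - of_int (p - 1) * \<beta>) * \<beta> ^ (r - 1)
    + 1 / 2 * binom (p - 1) (int r - 2) * (1 - of_int p * \<beta>) * (1 - of_int (p - 1) * \<beta>)
        * \<beta> ^ (r - 2))"

definition family_defined :: "nat \<Rightarrow> real \<Rightarrow> bool" where
  "family_defined n \<beta> \<longleftrightarrow> 0 < \<beta> \<and> \<beta> < 1 \<and> 0 < n \<and>
     (\<exists>d::nat. 0 < d \<and> real d = (1 - \<beta>) * real n \<and> \<not> (odd n \<and> odd d))"

definition family_partition :: "'a set \<Rightarrow> 'a set set \<Rightarrow> nat \<Rightarrow> real \<Rightarrow> (nat \<Rightarrow> 'a set) \<Rightarrow> bool" where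
  "family_partition V E n \<beta> P \<longleftrightarrow>
     (let p = nat (pval \<beta>) in
       family_defined n \<beta> \<and> sgraph V E \<and> card V = n \<and>
       (\<Union>i<p. P i) = V \<and>
       (\<forall>i<p. \<forall>j<p. i \<noteq> j \<longrightarrow> P i \<inter> P j = {}) \<and>
       real (card (P 0)) = (1 - (real p - 1) * \<beta>) * real n \<and>
       (\<forall>i. 1 \<le> i \<and> i \<le> p - 1 \<longrightarrow> real (card (P i)) = \<beta> * real n) \<and>
       (\<forall>i<p. \<forall>j<p. i < j \<longrightarrow> (\<forall>x\<in>P i. \<forall>y\<in>P j. {x, y} \<in> E)) \<and>
       (\<forall>i. 1 \<le> i \<and> i \<le> p - 1 \<longrightarrow> (\<forall>x\<in>P i. \<forall>y\<in>P i. {x, y} \<notin> E)) \<and>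
       (\<exists>d::nat. real d = (1 - real p * \<beta>) * real n \<and>
          regular (P 0) (induced E (P 0)) d \<and>
          (\<forall>(W :: nat set) F. sgraph W F \<and> card W = card (P 0) \<and> regular W F d \<longrightarrow>
              kcl 3 (P 0) (induced E (P 0)) \<le> kcl 3 W F)))"

definition in_family :: "'a set \<Rightarrow> 'a set set \<Rightarrow> nat \<Rightarrow> real \<Rightarrow> bool" where
  "in_family V E n \<beta> \<longleftrightarrow> (\<exists>P. family_partition V E n \<beta> P)"

definition feasible :: "nat \<Rightarrow> real \<Rightarrow> bool" where
  "feasible n \<beta> \<longleftrightarrow> family_defined n \<beta> \<and>
     (\<forall>(V :: nat set) E P. family_partition V E n \<beta> P \<longrightarrow>
        kcl 3 (P 0) (induced E (P 0)) = 0)"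

end

theory Submission
  imports Defs
begin

text \<open>
  Put b = n - \<delta> and d = 2 \<delta> - n, so that d \<le> b, let D(e) be the number of triangles on an edge e,
  and let m(e) = min (D(e)) b. Every edge has D(e) \<ge> d. In a triangle the three values m(e) add up
  to at least 3 \<delta> - n: if no D(e) exceeds b this is inclusion-exclusion for the three
  neighbourhoods, and otherwise the sum is at least b + 2 d = 3 \<delta> - n. On the other hand
  D(e) m(e) \<le> \<delta> D(e) - b d, which for D(e) \<le> b is (D(e) - d) (b - D(e)) \<ge> 0. Summing the first
  inequality over all triangles and using the second for every edge gives
  (3 \<delta> - n) k \<le> 3 \<delta> k - b d |E| for the number k of triangles, hence n k \<ge> b d |E| \<ge> b d n \<delta> / 2.

  In case of equality the graph is \<delta>-regular and K4-free and some edge uv has D(uv) = b. The common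
  neighbourhood of u and v is then an independent set of size n - \<delta>, so by regularity it is joined
  completely to its complement, which induces a triangle-free regular graph.
\<close>

section \<open>Ordered edges and triangles, double counting\<close>

definition nbr :: "'a set set \<Rightarrow> 'a \<Rightarrow> 'a set" where
  "nbr E v = {u. {u, v} \<in> E}"

text \<open>Ordered pairs and triples turn counting into sums over sigma sets. Each edge occurs
  twice here, and each triangle six times in \<open>triangles\<close>.\<close>

definition arcs :: "'a set set \<Rightarrow> ('a \<times> 'a) set" where
  "arcs E = {(x, y). {x, y} \<in> E}"

definition triangles :: "'a set set \<Rightarrow> ('a \<times> 'a \<times> 'a) set" where
  "triangles E = {(x, y, z). {x, y} \<in> E \<and> {y, z} \<in> E \<and> {x, z} \<in> E}"

definition codeg :: "'a set set \<Rightarrow> 'a \<Rightarrow> 'a \<Rightarrow> nat" where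
  "codeg E x y = card (nbr E x \<inter> nbr E y)"

lemma degree_nbr: "degree E v = card (nbr E v)"
  by (simp add: degree_def nbr_def)

lemma codeg_commute: "codeg E x y = codeg E y x"
  by (simp add: codeg_def Int_commute)

lemma sgraph_edgeD:
  assumes "sgraph V E" "{x, y} \<in> E"
  shows "x \<in> V" "y \<in> V" "x \<noteq> y"
  using assms by (auto simp: sgraph_def card_2_iff subset_iff doubleton_eq_iff)

lemma sgraph_finite: "sgraph V E \<Longrightarrow> finite V"
  by (simp add: sgraph_def)

lemma nbr_subset: "sgraph V E \<Longrightarrow> nbr E v \<subseteq> V"
  using sgraph_edgeD by (fastforce simp: nbr_def)

lemma finite_nbr: "sgraph V E \<Longrightarrow> finite (nbr E v)"
  using finite_subset nbr_subset sgraph_finite by metis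

lemma nbr_sym: "x \<in> nbr E y \<longleftrightarrow> y \<in> nbr E x"
  by (simp add: nbr_def insert_commute)

lemma arcs_Sigma: "sgraph V E \<Longrightarrow> arcs E = (SIGMA x:V. nbr E x)"
  by (auto simp: arcs_def nbr_def insert_commute dest: sgraph_edgeD)

lemma finite_arcs: "sgraph V E \<Longrightarrow> finite (arcs E)"
  by (auto simp: arcs_Sigma sgraph_finite finite_nbr)

lemma card_arcs: "sgraph V E \<Longrightarrow> card (arcs E) = (\<Sum>v\<in>V. degree E v)"
  by (simp add: arcs_Sigma sgraph_finite finite_nbr degree_nbr)

lemma triangles_Sigma:
  "triangles E = (\<lambda>((x, y), z). (x, y, z)) ` (SIGMA p:arcs E. nbr E (fst p) \<inter> nbr E (snd p))"
  by (force simp: triangles_def arcs_def nbr_def insert_commute image_iff)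

lemma finite_triangles: "sgraph V E \<Longrightarrow> finite (triangles E)"
  by (auto simp: triangles_Sigma finite_arcs finite_nbr)

text \<open>The third vertex of a triangle ranges over the common neighbours of the first two, so a
  weight that ignores it is repeated \<open>codeg E x y\<close> times.\<close>

lemma sum_triangles:
  fixes w :: "'a \<Rightarrow> 'a \<Rightarrow> int"
  assumes "sgraph V E"
  shows "(\<Sum>(x, y, z)\<in>triangles E. w x y) = (\<Sum>(x, y)\<in>arcs E. int (codeg E x y) * w x y)"
proof -
  have inj: "inj_on (\<lambda>((x, y), z). (x, y, z)) (SIGMA p:arcs E. nbr E (fst p) \<inter> nbr E (snd p))"
    by (auto simp: inj_on_def)
  have "(\<Sum>(x, y, z)\<in>triangles E. w x y)
      = (\<Sum>(p, z)\<in>(SIGMA p:arcs E. nbr E (fst p) \<inter> nbr E (snd p)). w (fst p) (snd p))"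
    unfolding triangles_Sigma by (subst sum.reindex[OF inj]) (auto intro!: sum.cong)
  also have "\<dots> = (\<Sum>p\<in>arcs E. \<Sum>z\<in>nbr E (fst p) \<inter> nbr E (snd p). w (fst p) (snd p))"
    by (rule sum.Sigma[symmetric]) (auto simp: finite_arcs[OF assms] finite_nbr[OF assms])
  finally show ?thesis
    by (simp add: codeg_def case_prod_beta)
qed

lemma card_triangles_codeg:
  assumes "sgraph V E"
  shows "int (card (triangles E)) = (\<Sum>(x, y)\<in>arcs E. int (codeg E x y))"
  using sum_triangles[OF assms, of "\<lambda>x y. 1"] by (simp add: case_prod_beta)

text \<open>Permuting the coordinates maps \<open>triangles E\<close> bijectively to itself, so for
  a symmetric weight the three summands have equal totals.\<close>

lemma sum_triangles_cyclic:
  fixes w :: "'a \<Rightarrow> 'a \<Rightarrow> int"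
  assumes "\<And>x y. w x y = w y x"
  shows "(\<Sum>(x, y, z)\<in>triangles E. w x y + w y z + w x z) = 3 * (\<Sum>(x, y, z)\<in>triangles E. w x y)"
proof -
  have 1: "(\<Sum>(x, y, z)\<in>triangles E. w y z) = (\<Sum>(x, y, z)\<in>triangles E. w x y)"
    by (rule sum.reindex_bij_witness[where i = "\<lambda>(x, y, z). (z, x, y)" and j = "\<lambda>(x, y, z). (y, z, x)"])
      (auto simp: triangles_def insert_commute)
  have 2: "(\<Sum>(x, y, z)\<in>triangles E. w x z) = (\<Sum>(x, y, z)\<in>triangles E. w x y)"
    by (rule sum.reindex_bij_witness[where i = "\<lambda>(x, y, z). (x, z, y)" and j = "\<lambda>(x, y, z). (x, z, y)"])
      (auto simp: triangles_def insert_commute)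
  show ?thesis using 1 2 by (simp add: case_prod_beta sum.distrib)
qed

lemma card_orderings:
  assumes "x \<noteq> y" "y \<noteq> z" "x \<noteq> z"
  shows "card {(a, b, c). {a, b, c} = {x, y, z}} = 6"
proof -
  have "{a, b, c} = {x, y, z} \<longleftrightarrow>
      (a = x \<and> b = y \<and> c = z) \<or> (a = x \<and> b = z \<and> c = y) \<or> (a = y \<and> b = x \<and> c = z) \<or>
      (a = y \<and> b = z \<and> c = x) \<or> (a = z \<and> b = x \<and> c = y) \<or> (a = z \<and> b = y \<and> c = x)" for a b c
    using assms by (smt (verit, best) insert_commute insert_iff singletonD)
  then have "{(a, b, c). {a, b, c} = {x, y, z}}
      = {(x, y, z), (x, z, y), (y, x, z), (y, z, x), (z, x, y), (z, y, x)}"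
    by auto
  then show ?thesis using assms by simp
qed

text \<open>Forgetting the order maps \<open>triangles E\<close> to the 3-cliques, and the fibre
  over a clique consists of its six orderings.\<close>

lemma card_triangles:
  assumes G: "sgraph V E"
  shows "card (triangles E) = 6 * kcl 3 V E"
proof -
  let ?f = "\<lambda>(x, y, z). {x, y, z}"
  let ?K = "{S. S \<subseteq> V \<and> card S = 3 \<and> is_clique E S}"
  have fK: "finite ?K"
    using sgraph_finite[OF G] by simp
  have img: "?f ` triangles E \<subseteq> ?K"
  proof (rule image_subsetI)
    fix t assume "t \<in> triangles E"
    then obtain x y z where xyz: "t = (x, y, z)" and t: "(x, y, z) \<in> triangles E"
      by (cases t) auto
    note ed = t[unfolded triangles_def, simplified]
    have ne: "x \<noteq> y" "y \<noteq> z" "x \<noteq> z" "x \<in> V" "y \<in> V" "z \<in> V"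
      using ed sgraph_edgeD[OF G] by blast+
    have "is_clique E {x, y, z}"
      using ed by (auto simp: is_clique_def insert_commute)
    then show "?f t \<in> ?K" using ne xyz by simp
  qed
  have fib: "card {t \<in> triangles E. ?f t = S} = 6" if S: "S \<in> ?K" for S
  proof -
    obtain x y z where xyz: "S = {x, y, z}" "x \<noteq> y" "y \<noteq> z" "x \<noteq> z"
      using S by (auto simp: card_3_iff)
    have cl: "\<And>a b. a \<in> S \<Longrightarrow> b \<in> S \<Longrightarrow> a \<noteq> b \<Longrightarrow> {a, b} \<in> E"
      using S by (auto simp: is_clique_def)
    have "t \<in> triangles E \<and> ?f t = S \<longleftrightarrow> t \<in> {(a, b, c). {a, b, c} = {x, y, z}}" for t
    proof (cases t)
      case (fields a b c)
      have "(a, b, c) \<in> triangles E" if eq: "{a, b, c} = {x, y, z}"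
      proof -
        have "card {a, b, c} = 3" unfolding eq using xyz by simp
        then have "a \<noteq> b" "b \<noteq> c" "a \<noteq> c" by (auto simp: card_insert_if split: if_splits)
        moreover have "a \<in> S" "b \<in> S" "c \<in> S" unfolding xyz(1) eq[symmetric] by simp_all
        ultimately show ?thesis using cl by (simp add: triangles_def)
      qed
      then show ?thesis unfolding fields xyz(1) by (simp only: split mem_Collect_eq) metis
    qed
    then have "{t \<in> triangles E. ?f t = S} = {(a, b, c). {a, b, c} = {x, y, z}}"
      by (intro set_eqI) (simp only: mem_Collect_eq)
    then show ?thesis using card_orderings[OF xyz(2-4)] by simp
  qed
  have "card (triangles E) = (\<Sum>t\<in>triangles E. 1)" by simp
  also have "\<dots> = (\<Sum>S\<in>?K. \<Sum>t\<in>{t \<in> triangles E. ?f t = S}. 1)"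
    by (rule sum.group[symmetric, OF finite_triangles[OF G] fK img])
  also have "\<dots> = (\<Sum>S\<in>?K. 6)"
  proof (rule sum.cong[OF refl])
    fix S assume "S \<in> ?K"
    from fib[OF this] show "(\<Sum>t\<in>{t \<in> triangles E. ?f t = S}. 1) = (6::nat)"
      unfolding card_eq_sum .
  qed
  finally show ?thesis by (simp add: kcl_def)
qed

text \<open>The handshake lemma. It later supplies the parity condition in
  \<open>family_defined\<close> for extremal graphs.\<close>

lemma even_card_arcs:
  assumes G: "sgraph V E"
  shows "even (card (arcs E))"
proof -
  let ?f = "\<lambda>(x, y). {x, y}"
  have fE: "finite E" using G by (auto simp: sgraph_def intro: finite_subset[of _ "Pow V"])
  have "card (arcs E) = (\<Sum>t\<in>arcs E. 1)" by simp
  also have "\<dots> = (\<Sum>S\<in>E. \<Sum>t\<in>{t \<in> arcs E. ?f t = S}. 1)"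
    by (rule sum.group[symmetric, OF finite_arcs[OF G] fE]) (auto simp: arcs_def)
  also have "\<dots> = (\<Sum>S\<in>E. 2)"
  proof (rule sum.cong)
    fix S assume S: "S \<in> E"
    then obtain x y where xy: "S = {x, y}" "x \<noteq> y"
      using G by (auto simp: sgraph_def card_2_iff)
    have "{t \<in> arcs E. ?f t = S} = {(x, y), (y, x)}"
      using xy S by (auto simp: arcs_def doubleton_eq_iff insert_commute)
    then show "(\<Sum>t\<in>{t \<in> arcs E. ?f t = S}. 1) = (2::nat)" using xy by simp
  qed simp
  finally show ?thesis by simp
qed

lemma card_Un3:
  assumes "finite A" "finite B" "finite C"
  shows "int (card (A \<union> B \<union> C)) = int (card A) + card B + card C
    - card (A \<inter> B) - card (B \<inter> C) - card (A \<inter> C) + card (A \<inter> B \<inter> C)"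
proof -
  have "card (A \<union> B) + card (A \<inter> B) = card A + card B"
    using card_Un_Int assms by metis
  moreover have "card (A \<union> B \<union> C) + card ((A \<union> B) \<inter> C) = card (A \<union> B) + card C"
    using card_Un_Int[of "A \<union> B" C] assms by simp
  moreover have "card ((A \<union> B) \<inter> C) + card (A \<inter> B \<inter> C) = card (A \<inter> C) + card (B \<inter> C)"
  proof -
    have "(A \<union> B) \<inter> C = A \<inter> C \<union> B \<inter> C" "A \<inter> B \<inter> C = A \<inter> C \<inter> (B \<inter> C)"
      by auto
    then show ?thesis using card_Un_Int[of "A \<inter> C" "B \<inter> C"] assms by simp
  qed
  ultimately show ?thesis by linarith
qed

section \<open>The counting inequality and its equality case\<close>

locale dense_graph =
  fixes V :: "'a set" and E n \<delta>
  assumes G: "sgraph V E" and n: "card V = n"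
    and deg: "v \<in> V \<Longrightarrow> \<delta> \<le> degree E v"
    and lower: "n < 2 * \<delta>" and upper: "3 * \<delta> \<le> 2 * n"
begin

text \<open>These are the quantities of the overview, with \<open>capped\<close> as m(e). They are
  integers so that subtraction is not truncated.\<close>

definition b :: int where "b = int n - int \<delta>"
definition d :: int where "d = 2 * int \<delta> - int n"
definition capped :: "'a \<Rightarrow> 'a \<Rightarrow> int" where "capped x y = min (int (codeg E x y)) b"

lemma d_pos: "0 < d" and d_le_b: "d \<le> b" and b_pos: "0 < b"
  using lower upper by (auto simp: b_def d_def)

lemma codeg_ge:
  assumes "{x, y} \<in> E"
  shows "d \<le> int (codeg E x y)"
proof -
  have "card (nbr E x \<union> nbr E y) + codeg E x y = degree E x + degree E y"
    using card_Un_Int[OF finite_nbr finite_nbr, OF G G, of x y]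
    by (simp add: codeg_def degree_nbr)
  moreover have "card (nbr E x \<union> nbr E y) \<le> n"
    using n nbr_subset[OF G] sgraph_finite[OF G] by (metis Un_least card_mono)
  moreover have "\<delta> \<le> degree E x" "\<delta> \<le> degree E y"
    using assms deg sgraph_edgeD[OF G] by blast+
  ultimately show ?thesis by (auto simp: d_def)
qed

text \<open>Inclusion-exclusion for three neighbourhoods inside a set of n vertices. The triple
  intersection is kept because the equality case uses it to exclude K4.\<close>

lemma triangle_codeg_ge:
  assumes "(x, y, z) \<in> triangles E"
  shows "3 * int \<delta> - int n + int (card (nbr E x \<inter> nbr E y \<inter> nbr E z))
    \<le> int (codeg E x y) + int (codeg E y z) + int (codeg E x z)"
proof -
  have "x \<in> V" "y \<in> V" "z \<in> V"
    using assms sgraph_edgeD[OF G] by (auto simp: triangles_def)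
  then have "\<delta> \<le> degree E x" "\<delta> \<le> degree E y" "\<delta> \<le> degree E z"
    using deg by blast+
  moreover have "card (nbr E x \<union> nbr E y \<union> nbr E z) \<le> n"
    using n nbr_subset[OF G] sgraph_finite[OF G] by (metis Un_least card_mono)
  ultimately show ?thesis
    using card_Un3[OF finite_nbr finite_nbr finite_nbr, OF G G G, of x y z]
    by (simp add: codeg_def degree_nbr)
qed

lemma triangle_capped_ge:
  assumes t: "(x, y, z) \<in> triangles E"
  shows "3 * int \<delta> - int n \<le> capped x y + capped y z + capped x z"
proof -
  have "d \<le> codeg E x y" "d \<le> codeg E y z" "d \<le> codeg E x z"
    using t codeg_ge by (auto simp: triangles_def)
  then show ?thesis
    using triangle_codeg_ge[OF t] d_le_b unfolding capped_def b_def d_def by linarith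
qed

lemma codeg_capped_le:
  assumes "{x, y} \<in> E"
  shows "int (codeg E x y) * capped x y \<le> int \<delta> * int (codeg E x y) - b * d"
proof (cases "int (codeg E x y) \<le> b")
  case True
  then have "(int (codeg E x y) - d) * (b - int (codeg E x y)) \<ge> 0"
    using codeg_ge[OF assms] by simp
  moreover have "int \<delta> = b + d" by (simp add: b_def d_def)
  ultimately show ?thesis using True by (simp add: capped_def algebra_simps)
next
  case False
  \<comment> \<open>Above the cap the two sides differ by exactly this product, since \<delta> - b =
    d.\<close>
  then have "d * (int (codeg E x y) - b) \<ge> 0" using d_pos by simp
  moreover have "int \<delta> = b + d" by (simp add: b_def d_def)
  ultimately show ?thesis using False by (simp add: capped_def algebra_simps)
qed

lemma codeg_capped_eqD:
  assumes e: "{x, y} \<in> E"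
    and eq: "int (codeg E x y) * capped x y = int \<delta> * int (codeg E x y) - b * d"
  shows "int (codeg E x y) = d \<or> int (codeg E x y) = b"
proof (cases "int (codeg E x y) \<le> b")
  case True
  have "int \<delta> = b + d" by (simp add: b_def d_def)
  then have "(int (codeg E x y) - d) * (b - int (codeg E x y)) = 0"
    using eq True by (simp add: capped_def algebra_simps)
  then show ?thesis by auto
next
  case False
  have "int \<delta> = b + d" by (simp add: b_def d_def)
  \<comment> \<open>As d > 0, this would put the codegree at b, against the case assumption that it
    exceeds b.\<close>
  then have "d * (int (codeg E x y) - b) = 0"
    using eq False by (simp add: capped_def algebra_simps)
  then show ?thesis using d_pos by auto
qed

lemma card_arcs_ge: "int n * int \<delta> \<le> int (card (arcs E))"
proof -
  have "(\<Sum>v\<in>V. \<delta>) \<le> (\<Sum>v\<in>V. degree E v)"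
    by (rule sum_mono) (rule deg)
  then have "n * \<delta> \<le> card (arcs E)"
    using card_arcs[OF G] n by simp
  then show ?thesis by (metis of_nat_le_iff of_nat_mult)
qed

text \<open>The excess over the bound is split into three slacks: of the triangles, of the edges and
  of the degree sum. All three are nonnegative, which gives the inequality; stated as an identity,
  it also forces each slack to vanish when equality holds.\<close>

lemma triangle_count_identity:
  "int n * int (card (triangles E)) - 3 * b * d * (int n * int \<delta>)
  = (\<Sum>(x, y, z)\<in>triangles E. capped x y + capped y z + capped x z - (3 * int \<delta> - int n))
  + 3 * (\<Sum>(x, y)\<in>arcs E. int \<delta> * int (codeg E x y) - b * d - int (codeg E x y) * capped x y)
  + 3 * b * d * (int (card (arcs E)) - int n * int \<delta>)"
proof -
  have sym: "capped x y = capped y x" for x y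
    by (simp add: capped_def codeg_commute)
  have 1: "(\<Sum>(x, y, z)\<in>triangles E. capped x y + capped y z + capped x z - (3 * int \<delta> - int n))
    = 3 * (\<Sum>(x, y)\<in>arcs E. int (codeg E x y) * capped x y)
      - (3 * int \<delta> - int n) * int (card (triangles E))"
    using sum_triangles_cyclic[of capped E, OF sym] sum_triangles[OF G, of capped]
    by (simp add: case_prod_beta sum_subtractf mult.commute)
  have 2: "(\<Sum>(x, y)\<in>arcs E. int \<delta> * int (codeg E x y) - b * d - int (codeg E x y) * capped x y)
    = int \<delta> * int (card (triangles E)) - b * d * int (card (arcs E))
      - (\<Sum>(x, y)\<in>arcs E. int (codeg E x y) * capped x y)"
    unfolding card_triangles_codeg[OF G]
    by (simp add: case_prod_beta sum_subtractf sum_distrib_left)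
  show ?thesis unfolding 1 2 by (simp add: algebra_simps)
qed

lemma triangle_slack_nonneg:
  "(case t of (x, y, z) \<Rightarrow> capped x y + capped y z + capped x z - (3 * int \<delta> - int n)) \<ge> 0"
  if "t \<in> triangles E"
  using that triangle_capped_ge by (cases t) (fastforce simp: algebra_simps)

lemma arc_slack_nonneg:
  "(case a of (x, y) \<Rightarrow> int \<delta> * int (codeg E x y) - b * d - int (codeg E x y) * capped x y) \<ge> 0"
  if "a \<in> arcs E"
  using that codeg_capped_le by (cases a) (simp add: arcs_def)

lemma n_pos: "0 < n"
  using lower upper by simp

theorem kcl3_ge: "b * d * int \<delta> \<le> 2 * int (kcl 3 V E)"
proof -
  have "0 \<le> int n * int (card (triangles E)) - 3 * b * d * (int n * int \<delta>)"
    unfolding triangle_count_identity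
    using card_arcs_ge d_pos b_pos
    by (intro add_nonneg_nonneg mult_nonneg_nonneg sum_nonneg triangle_slack_nonneg arc_slack_nonneg)
      auto
  then have "int n * (3 * (b * d * int \<delta>)) \<le> int n * (3 * (2 * int (kcl 3 V E)))"
    unfolding card_triangles[OF G] by (simp add: algebra_simps)
  then show ?thesis using n_pos by (simp add: ac_simps)
qed

text \<open>Equality makes the three slacks of \<open>triangle_count_identity\<close> zero, and a
  zero sum of nonnegative terms is zero termwise.\<close>

lemma extremal:
  assumes eq: "2 * int (kcl 3 V E) = b * d * int \<delta>"
  shows extremal_capped: "(x, y, z) \<in> triangles E \<Longrightarrow>
      capped x y + capped y z + capped x z = 3 * int \<delta> - int n"
    and extremal_codeg: "{x, y} \<in> E \<Longrightarrow> int (codeg E x y) = d \<or> int (codeg E x y) = b"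
    and extremal_regular: "v \<in> V \<Longrightarrow> degree E v = \<delta>"
proof -
  let ?S1 = "\<Sum>(x, y, z)\<in>triangles E. capped x y + capped y z + capped x z - (3 * int \<delta> - int n)"
  let ?S2 = "\<Sum>(x, y)\<in>arcs E. int \<delta> * int (codeg E x y) - b * d - int (codeg E x y) * capped x y"
  have "int n * int (card (triangles E)) - 3 * b * d * (int n * int \<delta>)
      = 3 * int n * (2 * int (kcl 3 V E) - b * d * int \<delta>)"
    unfolding card_triangles[OF G] by (simp add: algebra_simps)
  then have z: "?S1 + 3 * ?S2 + 3 * b * d * (int (card (arcs E)) - int n * int \<delta>) = 0"
    using triangle_count_identity eq by simp
  have n1: "0 \<le> ?S1" by (intro sum_nonneg triangle_slack_nonneg)
  have n2: "0 \<le> ?S2" by (intro sum_nonneg arc_slack_nonneg)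
  have n3: "0 \<le> 3 * b * d * (int (card (arcs E)) - int n * int \<delta>)"
    using card_arcs_ge d_pos b_pos by auto
  have z1: "?S1 = 0" and z2: "?S2 = 0" and z3: "3 * b * d * (int (card (arcs E)) - int n * int \<delta>) = 0"
    using z n1 n2 n3 by linarith+
  show "capped x y + capped y z + capped x z = 3 * int \<delta> - int n" if "(x, y, z) \<in> triangles E"
    using z1 that by (subst (asm) sum_nonneg_eq_0_iff[OF finite_triangles[OF G] triangle_slack_nonneg]) fastforce+
  show "int (codeg E x y) = d \<or> int (codeg E x y) = b" if "{x, y} \<in> E"
  proof (rule codeg_capped_eqD[OF that])
    show "int (codeg E x y) * capped x y = int \<delta> * int (codeg E x y) - b * d"
      using z2 that by (subst (asm) sum_nonneg_eq_0_iff[OF finite_arcs[OF G] arc_slack_nonneg])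
        (force simp: arcs_def)+
  qed
  have "(\<Sum>v\<in>V. degree E v) = (\<Sum>v\<in>V. \<delta>)"
    using z3 d_pos b_pos card_arcs[OF G] n
    by (simp flip: of_nat_mult of_nat_sum)
  \<comment> \<open>Every degree is at least \<delta>, so natural subtraction loses nothing here,
    and every summand is 0.\<close>
  then have "(\<Sum>v\<in>V. degree E v - \<delta>) = 0"
    using sum_subtractf_nat[of V "\<lambda>_. \<delta>" "degree E"] deg by simp
  then show "degree E v = \<delta>" if "v \<in> V"
    using that deg[OF that] sgraph_finite[OF G] by (simp add: le_antisym)
qed

end

section \<open>Joins of a graph with an independent set\<close>

text \<open>The shape of the family for p = 2: A plays the role of V_0 and the independent set B
  that of V_1.\<close>

definition join_partition :: "'a set \<Rightarrow> 'a set set \<Rightarrow> 'a set \<Rightarrow> 'a set \<Rightarrow> bool" where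
  "join_partition V E A B \<longleftrightarrow> A \<union> B = V \<and> A \<inter> B = {} \<and>
     (\<forall>x\<in>A. \<forall>y\<in>B. {x, y} \<in> E) \<and> (\<forall>x\<in>B. \<forall>y\<in>B. {x, y} \<notin> E)"

lemma sgraph_induced: "sgraph V E \<Longrightarrow> A \<subseteq> V \<Longrightarrow> sgraph A (induced E A)"
  by (auto simp: sgraph_def induced_def intro: finite_subset)

lemma nbr_induced: "x \<in> A \<Longrightarrow> nbr (induced E A) x = nbr E x \<inter> A"
  by (auto simp: nbr_def induced_def)

lemma triangle_free_iff:
  assumes "sgraph V E"
  shows "kcl 3 V E = 0 \<longleftrightarrow> triangles E = {}"
  using card_triangles[OF assms] finite_triangles[OF assms] by auto

context
  fixes V :: "'a set" and E A B
  assumes G: "sgraph V E" and join: "join_partition V E A B"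
begin

lemma join_finite: "finite A" "finite B"
  using join sgraph_finite[OF G] by (auto simp: join_partition_def)

lemma join_nbr_right: "y \<in> B \<Longrightarrow> nbr E y = A"
  using join nbr_subset[OF G, of y] by (auto simp: join_partition_def nbr_def)

lemma join_nbr_left: "x \<in> A \<Longrightarrow> nbr E x = nbr (induced E A) x \<union> B"
  using join nbr_subset[OF G, of x]
  by (auto simp: nbr_induced) (auto simp: join_partition_def nbr_def insert_commute)

lemma join_sgraph_left: "sgraph A (induced E A)"
  using sgraph_induced[OF G] join by (auto simp: join_partition_def)

lemma join_nbr_left_disjoint: "nbr (induced E A) x \<inter> B = {}"
  using nbr_subset[OF join_sgraph_left, of x] join by (auto simp: join_partition_def)

lemma join_degree_right: "y \<in> B \<Longrightarrow> degree E y = card A"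
  by (simp add: degree_nbr join_nbr_right)

lemma join_degree_left: "x \<in> A \<Longrightarrow> degree E x = degree (induced E A) x + card B"
  using join_nbr_left_disjoint finite_nbr[OF join_sgraph_left] join_finite
  by (simp add: degree_nbr join_nbr_left card_Un_disjoint)

text \<open>Each triangle consists of an edge inside A and a vertex of B. The count sums codegrees
  over ordered edges: an edge inside A has codegree |B| because A is triangle-free, and an edge
  between A and B has codegree k. Vertices of A thus contribute 2 k |B| each and vertices of B
  contribute |A| k each.\<close>

lemma join_card_triangles:
  assumes reg: "regular A (induced E A) k" and free: "kcl 3 A (induced E A) = 0"
  shows "card (triangles E) = 3 * card A * card B * k"
proof -
  have no: "triangles (induced E A) = {}"
    using free triangle_free_iff[OF join_sgraph_left] by simp
  have deg: "card (nbr (induced E A) x) = k" if "x \<in> A" for x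
    using reg that by (simp add: regular_def degree_nbr)
  have sub: "nbr (induced E A) x \<subseteq> A" for x
    by (rule nbr_subset[OF join_sgraph_left])
  have AB: "A \<inter> B = {}" "V = A \<union> B"
    using join by (auto simp: join_partition_def)
  have mixed: "codeg E x y = k" if "x \<in> A" "y \<in> B" for x y
  proof -
    have "nbr E x \<inter> nbr E y = nbr (induced E A) x"
      using that sub[of x] AB by (auto simp: join_nbr_left join_nbr_right)
    then show ?thesis using deg[OF that(1)] by (simp add: codeg_def)
  qed
  have inner: "codeg E x y = card B" if "x \<in> A" "y \<in> nbr (induced E A) x" for x y
  proof -
    have y: "y \<in> A" using that sub by auto
    have "nbr (induced E A) x \<inter> nbr (induced E A) y = {}"
    proof (rule ccontr)
      assume "nbr (induced E A) x \<inter> nbr (induced E A) y \<noteq> {}"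
      then obtain z where "z \<in> nbr (induced E A) x" "z \<in> nbr (induced E A) y" by auto
      then have "(x, y, z) \<in> triangles (induced E A)"
        using that by (auto simp: triangles_def nbr_def insert_commute)
      then show False using no by simp
    qed
    then have "nbr E x \<inter> nbr E y = B"
      using that y AB sub[of x] sub[of y] by (auto simp: join_nbr_left)
    then show ?thesis by (simp add: codeg_def)
  qed
  have left: "(\<Sum>y\<in>nbr E x. codeg E x y) = 2 * k * card B" if "x \<in> A" for x
  proof -
    have "(\<Sum>y\<in>nbr E x. codeg E x y)
        = (\<Sum>y\<in>nbr (induced E A) x. codeg E x y) + (\<Sum>y\<in>B. codeg E x y)"
      unfolding join_nbr_left[OF that]
      by (rule sum.union_disjoint[OF finite_nbr[OF join_sgraph_left] join_finite(2) join_nbr_left_disjoint])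
    also have "\<dots> = (\<Sum>y\<in>nbr (induced E A) x. card B) + (\<Sum>y\<in>B. k)"
      using that inner mixed by simp
    finally show ?thesis using deg[OF that] by simp
  qed
  have right: "(\<Sum>y\<in>nbr E x. codeg E x y) = card A * k" if "x \<in> B" for x
    using that mixed by (simp add: join_nbr_right codeg_commute[of E x])
  have "int (card (triangles E)) = int (\<Sum>(x, y)\<in>arcs E. codeg E x y)"
    unfolding card_triangles_codeg[OF G] by (simp add: case_prod_beta)
  then have "card (triangles E) = (\<Sum>(x, y)\<in>(SIGMA x:V. nbr E x). codeg E x y)"
    unfolding of_nat_eq_iff arcs_Sigma[OF G] .
  also have "\<dots> = (\<Sum>x\<in>V. \<Sum>y\<in>nbr E x. codeg E x y)"
    by (rule sum.Sigma[symmetric]) (auto simp: sgraph_finite[OF G] finite_nbr[OF G])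
  also have "\<dots> = (\<Sum>x\<in>A. \<Sum>y\<in>nbr E x. codeg E x y) + (\<Sum>x\<in>B. \<Sum>y\<in>nbr E x. codeg E x y)"
    unfolding AB(2) by (rule sum.union_disjoint[OF join_finite AB(1)])
  also have "\<dots> = 3 * card A * card B * k"
    by (simp add: left right algebra_simps)
  finally show ?thesis .
qed

end

section \<open>Structure of the extremal graphs\<close>

context dense_graph
begin

lemma extremal_structure:
  assumes eq: "2 * int (kcl 3 V E) = b * d * int \<delta>"
  obtains A B where "join_partition V E A B" "card A = \<delta>" "card B = n - \<delta>"
    "regular A (induced E A) (2 * \<delta> - n)" "kcl 3 A (induced E A) = 0"
proof -
  have codeg_le: "int (codeg E x y) \<le> b" if "{x, y} \<in> E" for x y
    using extremal_codeg[OF eq that] d_le_b by auto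
  \<comment> \<open>No codegree exceeds b, so capping changes nothing. The three codegrees then sum
    to exactly 3 \<delta> - n, which leaves no room for a common neighbour in
    \<open>triangle_codeg_ge\<close>.\<close>
  have K4_free: "nbr E x \<inter> nbr E y \<inter> nbr E z = {}" if t: "(x, y, z) \<in> triangles E" for x y z
  proof -
    have "{x, y} \<in> E" "{y, z} \<in> E" "{x, z} \<in> E"
      using t by (auto simp: triangles_def)
    note this[THEN codeg_le]
    then have "card (nbr E x \<inter> nbr E y \<inter> nbr E z) = 0"
      using extremal_capped[OF eq t] triangle_codeg_ge[OF t] unfolding capped_def by linarith
    then show ?thesis using finite_nbr[OF G] by simp
  qed
  have "0 < b * d * int \<delta>" using d_pos b_pos lower by simp
  then have "triangles E \<noteq> {}" using eq card_triangles[OF G] by auto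
  then obtain x y z where t: "(x, y, z) \<in> triangles E" by (metis ex_in_conv prod_cases3)
  \<comment> \<open>Codegrees are d or b. If b never occurred, a triangle would have capped sum 3 d,
    while 3 \<delta> - n = b + 2 d; hence d = b, a contradiction.\<close>
  have "\<exists>u v. {u, v} \<in> E \<and> int (codeg E u v) = b"
  proof (rule ccontr)
    assume none: "\<nexists>u v. {u, v} \<in> E \<and> int (codeg E u v) = b"
    have "{x, y} \<in> E" "{y, z} \<in> E" "{x, z} \<in> E"
      using t by (auto simp: triangles_def)
    then have "int (codeg E x y) = d" "int (codeg E y z) = d" "int (codeg E x z) = d" "d \<noteq> b"
      using none extremal_codeg[OF eq] by metis+
    then show False
      using extremal_capped[OF eq t] d_le_b by (simp add: capped_def b_def d_def)
  qed
  then obtain u v where uv: "{u, v} \<in> E" "int (codeg E u v) = b" by blast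
  define B where "B = nbr E u \<inter> nbr E v"
  define A where "A = V - B"
  have BV: "B \<subseteq> V" using nbr_subset[OF G] by (auto simp: B_def)
  then have AB: "A \<union> B = V" "A \<inter> B = {}" and AV: "A \<subseteq> V" by (auto simp: A_def)
  have fB: "finite B" using BV sgraph_finite[OF G] finite_subset by blast
  have cB: "int (card B) = int n - int \<delta>" using uv by (simp add: B_def codeg_def b_def)
  have "card B \<le> n" using BV n sgraph_finite[OF G] card_mono by blast
  moreover have "card A = n - card B" unfolding A_def using card_Diff_subset[OF fB BV] n by simp
  ultimately have cA: "card A = \<delta>" using cB by linarith
  \<comment> \<open>An edge inside B would form a K4 together with u and v.\<close>
  have indep: "{w, w'} \<notin> E" if w: "w \<in> B" "w' \<in> B" for w w'
  proof
    assume "{w, w'} \<in> E"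
    moreover have "(u, v, w) \<in> triangles E"
      using uv w by (auto simp: triangles_def B_def nbr_def insert_commute)
    ultimately show False
      using K4_free w by (fastforce simp: B_def nbr_def insert_commute)
  qed
  \<comment> \<open>Independence of B puts the neighbourhood inside A, and both sets have \<delta>
    elements.\<close>
  have nbr_B: "nbr E w = A" if w: "w \<in> B" for w
  proof -
    have "nbr E w \<subseteq> A"
      using indep[OF _ w] nbr_subset[OF G, of w] by (auto simp: A_def nbr_def)
    moreover have "card (nbr E w) = card A"
      using extremal_regular[OF eq] w BV cA by (auto simp: degree_nbr)
    ultimately show ?thesis
      using card_subset_eq AV sgraph_finite[OF G] finite_subset by metis
  qed
  have J: "join_partition V E A B"
    unfolding join_partition_def using AB indep nbr_B by (auto simp: nbr_def)
  have "regular A (induced E A) (2 * \<delta> - n)"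
    unfolding regular_def
  proof
    fix a assume a: "a \<in> A"
    then have "degree E a = \<delta>" using AV extremal_regular[OF eq] by blast
    then show "degree (induced E A) a = 2 * \<delta> - n"
      using join_degree_left[OF G J a] cB by linarith
  qed
  moreover have "triangles (induced E A) = {}"
  proof (rule ccontr)
    assume "triangles (induced E A) \<noteq> {}"
    then obtain x y z where t: "(x, y, z) \<in> triangles (induced E A)"
      by (metis ex_in_conv prod_cases3)
    then have t': "(x, y, z) \<in> triangles E" and xyz: "x \<in> A" "y \<in> A" "z \<in> A"
      by (auto simp: triangles_def induced_def)
    \<comment> \<open>Any vertex of B is adjacent to all of A and would extend a triangle inside A
      to a K4.\<close>
    have "B \<noteq> {}" using cB b_pos by (auto simp: b_def)
    then obtain w where w: "w \<in> B" by blast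
    then have "w \<in> nbr E x \<inter> nbr E y \<inter> nbr E z"
      using xyz nbr_B by (auto simp: nbr_sym[of w])
    then show False using K4_free[OF t'] by blast
  qed
  then have "kcl 3 A (induced E A) = 0"
    using triangle_free_iff[OF sgraph_induced[OF G AV]] by simp
  moreover have "card B = n - \<delta>" using cB by simp
  ultimately show thesis using that J cA by blast
qed

lemma extremal_even:
  assumes eq: "2 * int (kcl 3 V E) = b * d * int \<delta>"
  shows "even (n * \<delta>)"
proof -
  have "card (arcs E) = n * \<delta>"
    using extremal_regular[OF eq] n by (simp add: card_arcs[OF G])
  then show ?thesis using even_card_arcs[OF G] by simp
qed

end

section \<open>Constructions: joins, circulants, prescribed minimum degree\<close>

lemma join_graph:
  assumes F: "sgraph W F" and U: "finite U" "W \<inter> U = {}"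
    and E: "E = F \<union> {{x, y} |x y. x \<in> W \<and> y \<in> U}"
  shows "sgraph (W \<union> U) E" "join_partition (W \<union> U) E W U" "induced E W = F"
proof -
  have F_iff: "e \<in> F \<Longrightarrow> e \<subseteq> W \<and> card e = 2" for e
    using F by (auto simp: sgraph_def)
  have cross: "card {x, y} = 2" if "x \<in> W" "y \<in> U" for x y
  proof -
    have "x \<noteq> y" using that U(2) by blast
    then show ?thesis by simp
  qed
  have "e \<subseteq> W \<union> U \<and> card e = 2" if "e \<in> E" for e
  proof (cases "e \<in> F")
    case True
    then show ?thesis using F_iff by blast
  next
    case False
    then obtain x y where "e = {x, y}" "x \<in> W" "y \<in> U" using \<open>e \<in> E\<close> unfolding E by blast
    then show ?thesis using cross by simp
  qed
  then show "sgraph (W \<union> U) E"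
    unfolding sgraph_def using U(1) sgraph_finite[OF F] by blast
  have meets: "e \<inter> W \<noteq> {}" if "e \<in> E" for e
  proof (cases "e \<in> F")
    case True
    then have "e \<subseteq> W" "e \<noteq> {}" using F_iff by fastforce+
    then show ?thesis by blast
  next
    case False
    then show ?thesis using that unfolding E by blast
  qed
  have "{x, y} \<notin> E" if "x \<in> U" "y \<in> U" for x y
  proof
    assume "{x, y} \<in> E"
    from meets[OF this] show False using that U(2) by blast
  qed
  moreover have "{x, y} \<in> E" if "x \<in> W" "y \<in> U" for x y
    using that unfolding E by blast
  ultimately show "join_partition (W \<union> U) E W U"
    unfolding join_partition_def using U(2) by simp
  show "induced E W = F"
  proof (intro equalityI subsetI)
    fix e assume "e \<in> induced E W"
    then have "e \<in> E" "e \<inter> U = {}" using U(2) by (auto simp: induced_def)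
    then show "e \<in> F" unfolding E by blast
  next
    fix e assume "e \<in> F"
    then show "e \<in> induced E W" using F_iff by (simp add: induced_def E)
  qed
qed

text \<open>Circulant graphs: the connection set consists of the residues at distance at most
  d / 2 from 0, together with the antipode of 0 when d is odd.\<close>
lemma regular_graph_exists:
  assumes dm: "d < m" and ev: "even (d * m)"
  obtains F where "sgraph {..<m} F" "regular {..<m} F d"
proof -
  define S where "S = {1..d div 2} \<union> {m - d div 2..<m} \<union> (if odd d then {m div 2} else {})"
  have S_bounds: "0 < s \<and> s < m" if "s \<in> S" for s
    using that dm by (auto simp: S_def split: if_splits elim!: oddE)
  \<comment> \<open>S is closed under negation modulo m: the two intervals are exchanged, and for
    odd d the evenness of d m makes m even, so \<open>m div 2\<close> is its own negative. Hence the
    neighbourhood of x is just the shift of S by x.\<close>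
  have S_sym: "m - s \<in> S" if "s \<in> S" for s
    using that dm ev by (auto simp: S_def split: if_splits elim!: oddE evenE)
  have card_S: "card S = d"
  proof -
    have c: "card ({1..d div 2} \<union> {m - d div 2..<m}) = d div 2 + d div 2"
      using dm by (subst card_Un_disjoint) auto
    show ?thesis
    proof (cases "odd d")
      case True
      have "m div 2 \<notin> {1..d div 2} \<union> {m - d div 2..<m}"
        using True ev dm by (auto elim!: oddE evenE)
      then have "card S = Suc (d div 2 + d div 2)"
        using True c by (simp add: S_def)
      then show ?thesis using True by presburger
    next
      case False
      then show ?thesis using c by (simp add: S_def) presburger
    qed
  qed
  have shift: "(x + s) mod m = (if x + s < m then x + s else x + s - m)" if "x < m" "s < m" for x s
    using that by (simp add: mod_if)
  define F where "F = {{x, (x + s) mod m} |x s. x < m \<and> s \<in> S}"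
  have "e \<subseteq> {..<m} \<and> card e = 2" if "e \<in> F" for e
  proof -
    obtain x s where e: "e = {x, (x + s) mod m}" and x: "x < m" and s: "s \<in> S"
      using \<open>e \<in> F\<close> unfolding F_def by blast
    have "x \<noteq> (x + s) mod m" "(x + s) mod m < m"
      using x S_bounds[OF s] by (auto simp: shift)
    then show ?thesis using e x by simp
  qed
  then have "sgraph {..<m} F"
    unfolding sgraph_def by auto
  moreover have "regular {..<m} F d"
    unfolding regular_def
  proof
    fix x assume "x \<in> {..<m}"
    then have x: "x < m" by simp
    have "nbr F x = (\<lambda>s. (x + s) mod m) ` S"
    proof (intro equalityI subsetI)
      fix u assume "u \<in> nbr F x"
      then obtain x' s where e: "{u, x} = {x', (x' + s) mod m}" and s: "x' < m" "s \<in> S"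
        unfolding nbr_def F_def by blast
      consider "x = x'" "u = (x' + s) mod m" | "u = x'" "x = (x' + s) mod m"
        using e unfolding doubleton_eq_iff by blast
      then show "u \<in> (\<lambda>s. (x + s) mod m) ` S"
      proof cases
        case 1
        then show ?thesis using s by blast
      next
        case 2
        have "u = (x + (m - s)) mod m"
          using 2 s S_bounds[OF s(2)] by (simp add: shift)
        then show ?thesis using S_sym[OF s(2)] by blast
      qed
    next
      fix u assume "u \<in> (\<lambda>s. (x + s) mod m) ` S"
      then show "u \<in> nbr F x"
        using x unfolding nbr_def F_def insert_commute[of u] by blast
    qed
    moreover have "inj_on (\<lambda>s. (x + s) mod m) S"
    proof (rule inj_onI)
      fix s t assume st: "s \<in> S" "t \<in> S" and eq: "(x + s) mod m = (x + t) mod m"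
      show "s = t"
        using eq x S_bounds[OF st(1)] S_bounds[OF st(2)] by (auto simp: shift split: if_splits)
    qed
    ultimately show "degree F x = d"
      by (simp add: degree_nbr card_image card_S)
  qed
  ultimately show thesis by (rule that)
qed

text \<open>Shows that the set under the infimum in \<open>kmin\<close> is nonempty, so that the
  infimum is attained.\<close>

lemma min_degree_graph_exists:
  assumes "\<delta> < n"
  shows "\<exists>(V :: nat set) E. sgraph V E \<and> card V = n \<and> min_degree V E = \<delta>"
proof -
  \<comment> \<open>The complete graph on n vertices, except that vertex 0 keeps only the neighbours
    1, ..., \<delta>.\<close>
  define E where "E = {{i, j} |i j :: nat. i < n \<and> j < i \<and> (j = 0 \<longrightarrow> i \<le> \<delta>)}"
  have G: "sgraph {..<n} E"
    by (auto simp: sgraph_def E_def)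
  have E_iff: "{i, j} \<in> E \<longleftrightarrow> i < n \<and> (j = 0 \<longrightarrow> i \<le> \<delta>)" if "j < i" for i j
  proof
    assume "{i, j} \<in> E"
    then obtain i' j' where "{i, j} = {i', j'}" "i' < n" "j' < i'" "j' = 0 \<longrightarrow> i' \<le> \<delta>"
      unfolding E_def by blast
    then show "i < n \<and> (j = 0 \<longrightarrow> i \<le> \<delta>)"
      using that unfolding doubleton_eq_iff by force
  qed (use that E_def in blast)
  have E_iff': "{j, i} \<in> E \<longleftrightarrow> i < n \<and> (j = 0 \<longrightarrow> i \<le> \<delta>)" if "j < i" for i j
    using E_iff[OF that] by (simp add: insert_commute)
  have "u \<in> nbr E 0 \<longleftrightarrow> u \<in> {1..\<delta>}" for u
    using E_iff[of 0 u] sgraph_edgeD(3)[OF G, of 0 0] assms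
    by (cases "u = 0") (auto simp: nbr_def)
  then have "nbr E 0 = {1..\<delta>}" by blast
  then have d0: "degree E 0 = \<delta>" by (simp add: degree_nbr)
  have "\<delta> \<le> degree E v" if "v < n" for v
  proof (cases "\<delta> < v")
    case True
    \<comment> \<open>Such a vertex misses only 0 and itself, and \<delta> < v < n gives \<delta>
      \<le> n - 2.\<close>
    have "u \<in> nbr E v" if "u \<in> {1..<n} - {v}" for u
      using that \<open>v < n\<close> True E_iff[of v u] E_iff'[of u v]
      by (cases u v rule: linorder_cases) (auto simp: nbr_def insert_commute)
    then have "{1..<n} - {v} \<subseteq> nbr E v" by blast
    then have "card ({1..<n} - {v}) \<le> degree E v"
      unfolding degree_nbr by (rule card_mono[OF finite_nbr[OF G]])
    then show ?thesis using that True by simp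
  next
    case False
    show ?thesis
    proof (cases "v = 0")
      case True
      then show ?thesis using d0 by simp
    next
      case v: False
      have "u \<in> nbr E v" if "u \<in> {..<n} - {v}" for u
        using that \<open>v < n\<close> False v E_iff[of v u] E_iff'[of u v]
        by (cases u v rule: linorder_cases) (auto simp: nbr_def insert_commute)
      then have "{..<n} - {v} \<subseteq> nbr E v" by blast
      then have "card ({..<n} - {v}) \<le> degree E v"
        unfolding degree_nbr by (rule card_mono[OF finite_nbr[OF G]])
      then show ?thesis using that assms by simp
    qed
  qed
  then have "min_degree {..<n} E = \<delta>"
    unfolding min_degree_def using d0 assms by (intro Min_eqI) (auto intro!: image_eqI[of _ _ 0])
  then show ?thesis using G by (intro exI[of _ "{..<n}"] exI[of _ E]) auto
qed

lemma kmin_attained: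
  assumes "\<delta> < n"
  obtains V :: "nat set" and E where "sgraph V E" "card V = n" "min_degree V E = \<delta>"
    "kcl r V E = kmin r n \<delta>"
proof -
  have "kmin r n \<delta> \<in> {kcl r V E | (V :: nat set) E. sgraph V E \<and> card V = n \<and> min_degree V E = \<delta>}"
    unfolding kmin_def using min_degree_graph_exists[OF assms] by (intro Inf_nat_def1) blast
  then show thesis using that by auto
qed

lemma kmin_le:
  fixes V :: "nat set"
  assumes "sgraph V E" "card V = n" "min_degree V E = \<delta>"
  shows "kmin r n \<delta> \<le> kcl r V E"
  unfolding kmin_def using assms by (intro cInf_lower) auto

lemma regular_min_degree:
  assumes "finite V" "V \<noteq> {}" "\<And>v. v \<in> V \<Longrightarrow> degree E v = k"
  shows "min_degree V E = k"
  unfolding min_degree_def using assms by (intro Min_eqI) auto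

lemma min_degree_le: "finite V \<Longrightarrow> v \<in> V \<Longrightarrow> min_degree V E \<le> degree E v"
  by (simp add: min_degree_def)

section \<open>The definitions in terms of n and \<delta>, with p = 2\<close>

locale density =
  fixes n \<delta> :: nat and \<beta> :: real
  assumes lower: "n < 2 * \<delta>" and upper: "3 * \<delta> \<le> 2 * n" and \<beta>: "\<beta> = 1 - real \<delta> / real n"
begin

lemma n_pos: "0 < n" and \<delta>_pos: "0 < \<delta>" and \<delta>_less: "\<delta> < n"
  using lower upper by auto

lemma \<beta>_n: "\<beta> * real n = real (n - \<delta>)"
  using n_pos \<delta>_less by (simp add: \<beta> field_simps of_nat_diff)

lemma \<beta>_range: "1 / 3 \<le> \<beta>" "\<beta> < 1 / 2"
  using lower upper n_pos by (auto simp: \<beta> field_simps)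

lemma pval_\<beta>: "pval \<beta> = 2"
proof -
  have "2 < 1 / \<beta>" "1 / \<beta> \<le> 3"
    using \<beta>_range by (auto simp: field_simps)
  then have "\<lceil>1 / \<beta>\<rceil> = 3" by (intro ceiling_unique) auto
  then show ?thesis by (simp add: pval_def)
qed

lemma gfun_3: "gfun 3 \<beta> = 1 / 2 * (1 - 2 * \<beta>) * (1 - \<beta>) * \<beta>"
  by (simp add: gfun_def pval_\<beta> binom_def)

text \<open>The right-hand side is half of the natural number b d \<delta>, so later comparisons
  with g_3 can be made in the naturals.\<close>

lemma gfun_n: "gfun 3 \<beta> * real n ^ 3 = real ((n - \<delta>) * (2 * \<delta> - n) * \<delta>) / 2"
proof -
  have 1: "(1 - 2 * \<beta>) * real n = real (2 * \<delta> - n)" and 2: "(1 - \<beta>) * real n = real \<delta>"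
    using \<beta>_n \<delta>_less lower by (auto simp: algebra_simps of_nat_diff)
  have "gfun 3 \<beta> * real n ^ 3
      = (\<beta> * real n) * ((1 - 2 * \<beta>) * real n) * ((1 - \<beta>) * real n) / 2"
    by (simp add: gfun_3 power3_eq_cube)
  then show ?thesis unfolding \<beta>_n 1 2 by simp
qed

lemma family_defined_iff: "family_defined n \<beta> \<longleftrightarrow> even (n * \<delta>)"
proof -
  have "real d = (1 - \<beta>) * real n \<longleftrightarrow> d = \<delta>" for d
    using \<beta>_n \<delta>_less by (auto simp: algebra_simps of_nat_diff)
  then show ?thesis
    using \<beta>_range n_pos \<delta>_pos by (auto simp: family_defined_def)
qed

text \<open>For p = 2 there are just the two parts \<open>P 0\<close> and \<open>P 1\<close>, and
  the real-valued size conditions pin down natural numbers.\<close>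

lemma family_partition_iff:
  "family_partition V E n \<beta> P \<longleftrightarrow> even (n * \<delta>) \<and> sgraph V E \<and> card V = n \<and>
     join_partition V E (P 0) (P 1) \<and> card (P 0) = \<delta> \<and> card (P 1) = n - \<delta> \<and>
     regular (P 0) (induced E (P 0)) (2 * \<delta> - n) \<and>
     (\<forall>(W :: nat set) F. sgraph W F \<and> card W = \<delta> \<and> regular W F (2 * \<delta> - n) \<longrightarrow>
        kcl 3 (P 0) (induced E (P 0)) \<le> kcl 3 W F)"
proof -
  have 2: "(\<forall>i<2. Q i) \<longleftrightarrow> Q 0 \<and> Q 1" for Q :: "nat \<Rightarrow> bool"
    by (auto simp: less_2_cases_iff)
  have 1: "(\<forall>i. 1 \<le> i \<and> i \<le> 2 - 1 \<longrightarrow> Q i) \<longleftrightarrow> Q 1" for Q :: "nat \<Rightarrow> bool"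
    by (metis le_antisym le_refl one_add_one add_diff_cancel_left')
  have U: "(\<Union>i<2. P i) = P 0 \<union> P 1"
    by (auto simp: less_2_cases_iff)
  have k: "real k = (1 - real 2 * \<beta>) * real n \<longleftrightarrow> k = 2 * \<delta> - n" for k
  proof -
    have "(1 - real 2 * \<beta>) * real n = real (2 * \<delta> - n)"
      using \<beta>_n \<delta>_less lower by (simp add: algebra_simps of_nat_diff)
    then show ?thesis by simp
  qed
  have c0: "real k = (1 - (real 2 - 1) * \<beta>) * real n \<longleftrightarrow> k = \<delta>" for k
    using \<beta>_n \<delta>_less by (auto simp: algebra_simps of_nat_diff)
  have c1: "real k = \<beta> * real n \<longleftrightarrow> k = n - \<delta>" for k
    unfolding \<beta>_n by simp
  show ?thesis
    unfolding family_partition_def pval_\<beta> Let_def nat_numeral 2 1 U k c0 c1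
      family_defined_iff join_partition_def
    by (auto simp: Int_commute)
qed

text \<open>\<open>feasible\<close> quantifies universally over the family, so a member is required
  to keep it from holding vacuously. A regular graph with the fewest triangles is joined to n -
  \<delta> new independent vertices.\<close>

lemma family_nonempty:
  assumes ev: "even (n * \<delta>)"
  obtains V :: "nat set" and E P where "family_partition V E n \<beta> P"
proof -
  let ?Q = "\<lambda>(W :: nat set, F). sgraph W F \<and> card W = \<delta> \<and> regular W F (2 * \<delta> - n)"
  \<comment> \<open>2 \<delta> - n and n have the same parity; this is the condition for a circulant
    of degree 2 \<delta> - n on \<delta> vertices.\<close>
  have "even ((2 * \<delta> - n) * \<delta>)"
    using ev lower by (auto simp: even_diff_nat)
  moreover have "2 * \<delta> - n < \<delta>" using \<delta>_less lower by linarith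
  ultimately obtain F where "sgraph {..<\<delta>} F" "regular {..<\<delta>} F (2 * \<delta> - n)"
    using regular_graph_exists by metis
  then have "?Q ({..<\<delta>}, F)" by simp
  then obtain WF where WF: "?Q WF" and least: "\<And>G. ?Q G \<Longrightarrow> case_prod (kcl 3) WF \<le> case_prod (kcl 3) G"
    using ex_has_least_nat[of ?Q _ "case_prod (kcl 3)"] by blast
  obtain W F where WF_eq: "WF = (W, F)" by fastforce
  have W: "sgraph W F" "card W = \<delta>" "regular W F (2 * \<delta> - n)"
    using WF WF_eq by auto
  have minimal: "kcl 3 W F \<le> kcl 3 W' F'"
    if "sgraph W' F' \<and> card W' = \<delta> \<and> regular W' F' (2 * \<delta> - n)" for W' :: "nat set" and F'
    using least[of "(W', F')"] that WF_eq by simp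
  have "infinite (- W)" using sgraph_finite[OF W(1)] by (simp add: Compl_eq_Diff_UNIV)
  then obtain U where U: "U \<subseteq> - W" "card U = n - \<delta>" "finite U"
    using infinite_arbitrarily_large by metis
  define E where "E = F \<union> {{x, y} |x y. x \<in> W \<and> y \<in> U}"
  have dis: "W \<inter> U = {}" using U by auto
  note J = join_graph[OF W(1) U(3) dis E_def]
  have "card (W \<union> U) = n"
    using card_Un_disjoint[OF sgraph_finite[OF W(1)] U(3) dis] U W \<delta>_less by simp
  then have "family_partition (W \<union> U) E n \<beta> (\<lambda>i. if i = 0 then W else U)"
    unfolding family_partition_iff using J W U ev minimal by simp
  then show thesis by (rule that)
qed

text \<open>From left to right, a member given by \<open>family_nonempty\<close> supplies its part
  \<open>P 0\<close> as witness. Conversely, a triangle-free competitor F forces every minimal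
  \<open>P 0\<close> to be triangle-free.\<close>

lemma feasible_iff:
  "feasible n \<beta> \<longleftrightarrow> even (n * \<delta>) \<and>
    (\<exists>(W :: nat set) F. sgraph W F \<and> card W = \<delta> \<and> regular W F (2 * \<delta> - n) \<and> kcl 3 W F = 0)"
proof (cases "even (n * \<delta>)")
  case True
  obtain V :: "nat set" and E P where P: "family_partition V E n \<beta> P"
    using family_nonempty[OF True] .
  have "sgraph (P 0) (induced E (P 0))"
    using P unfolding family_partition_iff by (blast intro: join_sgraph_left)
  then show ?thesis
    unfolding feasible_def family_defined_iff using P True family_partition_iff
    by (smt (verit, ccfv_threshold) le_zero_eq)
next
  case False
  then show ?thesis by (simp add: feasible_def family_defined_iff)
qed

section \<open>Extremal graphs and the family\<close>

context
  fixes V :: "'a set" and E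
  assumes G: "sgraph V E" and card_V: "card V = n" and min_deg: "min_degree V E = \<delta>"
begin

lemma dense_graph: "dense_graph V E n \<delta>"
  using G card_V min_deg lower upper min_degree_le[OF sgraph_finite[OF G], of _ E]
  by unfold_locales auto

lemma bound_nat:
  "dense_graph.b n \<delta> * dense_graph.d n \<delta> * int \<delta> = int ((n - \<delta>) * (2 * \<delta> - n) * \<delta>)"
  using \<delta>_less lower
  by (simp add: dense_graph.b_def[OF dense_graph] dense_graph.d_def[OF dense_graph] of_nat_diff)

lemma kcl3_lower: "(n - \<delta>) * (2 * \<delta> - n) * \<delta> \<le> 2 * kcl 3 V E"
  using dense_graph.kcl3_ge[OF dense_graph] unfolding bound_nat by linarith

lemma extremal_join:
  assumes "2 * kcl 3 V E = (n - \<delta>) * (2 * \<delta> - n) * \<delta>"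
  obtains A B where "even (n * \<delta>)" "join_partition V E A B" "card A = \<delta>" "card B = n - \<delta>"
    "regular A (induced E A) (2 * \<delta> - n)" "kcl 3 A (induced E A) = 0"
proof -
  have eq: "2 * int (kcl 3 V E) = dense_graph.b n \<delta> * dense_graph.d n \<delta> * int \<delta>"
    unfolding bound_nat using assms by linarith
  show thesis
    using dense_graph.extremal_structure[OF dense_graph eq]
      dense_graph.extremal_even[OF dense_graph eq] that by metis
qed

text \<open>The part A given by \<open>extremal_join\<close> has no triangles, so the minimality
  clause of the family holds trivially.\<close>

lemma extremal_in_family:
  assumes "2 * kcl 3 V E = (n - \<delta>) * (2 * \<delta> - n) * \<delta>"
  shows "in_family V E n \<beta>"
proof -
  obtain A B where AB: "even (n * \<delta>)" "join_partition V E A B" "card A = \<delta>" "card B = n - \<delta>"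
    "regular A (induced E A) (2 * \<delta> - n)" "kcl 3 A (induced E A) = 0"
    using extremal_join[OF assms] .
  then have "family_partition V E n \<beta> (\<lambda>i. if i = 0 then A else B)"
    unfolding family_partition_iff using G card_V by simp
  then show ?thesis unfolding in_family_def by blast
qed

end

lemma extremal_feasible:
  fixes V :: "nat set"
  assumes G: "sgraph V E" "card V = n" "min_degree V E = \<delta>"
    and eq: "2 * kcl 3 V E = (n - \<delta>) * (2 * \<delta> - n) * \<delta>"
  shows "feasible n \<beta>"
proof -
  obtain A B where AB: "even (n * \<delta>)" "join_partition V E A B" "card A = \<delta>" "card B = n - \<delta>"
    "regular A (induced E A) (2 * \<delta> - n)" "kcl 3 A (induced E A) = 0"
    using extremal_join[OF G eq] .
  then show ?thesis
    unfolding feasible_iff using join_sgraph_left[OF G(1) AB(2)] by blast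
qed

text \<open>Feasibility provides a triangle-free competitor, so minimality makes \<open>P 0\<close>
  triangle-free and \<open>join_card_triangles\<close> gives the exact count.\<close>

lemma in_family_count:
  assumes feas: "feasible n \<beta>" and fam: "in_family V E n \<beta>"
  shows "2 * kcl 3 V E = (n - \<delta>) * (2 * \<delta> - n) * \<delta>"
proof -
  obtain P where P: "family_partition V E n \<beta> P"
    using fam unfolding in_family_def by blast
  note P' = P[unfolded family_partition_iff]
  obtain W :: "nat set" and F where W: "sgraph W F" "card W = \<delta>" "regular W F (2 * \<delta> - n)" "kcl 3 W F = 0"
    using feas unfolding feasible_iff by blast
  have "kcl 3 (P 0) (induced E (P 0)) \<le> kcl 3 W F"
    using P' W(1-3) by blast
  then have "kcl 3 (P 0) (induced E (P 0)) = 0" using W(4) by simp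
  then have "card (triangles E) = 3 * card (P 0) * card (P 1) * (2 * \<delta> - n)"
    using P' join_card_triangles[of V E "P 0" "P 1" "2 * \<delta> - n"] by blast
  moreover have "card (P 0) = \<delta>" "card (P 1) = n - \<delta>" "sgraph V E"
    using P' by blast+
  ultimately have "3 * (2 * kcl 3 V E) = 3 * ((n - \<delta>) * (2 * \<delta> - n) * \<delta>)"
    by (simp add: card_triangles)
  then show ?thesis by simp
qed

text \<open>Members are \<delta>-regular: vertices of \<open>P 0\<close> have degree (2 \<delta> -
  n) + (n - \<delta>), and those of \<open>P 1\<close> are joined to all \<delta> vertices of
  \<open>P 0\<close>. Hence members are admissible in \<open>kmin\<close>.\<close>

lemma in_family_min_degree:
  assumes "in_family V E n \<beta>"
  shows "min_degree V E = \<delta>"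
proof -
  obtain P where "family_partition V E n \<beta> P"
    using assms unfolding in_family_def by blast
  then have G: "sgraph V E" and V: "card V = n" and J: "join_partition V E (P 0) (P 1)"
    and card: "card (P 0) = \<delta>" "card (P 1) = n - \<delta>"
    and reg: "regular (P 0) (induced E (P 0)) (2 * \<delta> - n)"
    unfolding family_partition_iff by blast+
  have "degree E v = \<delta>" if "v \<in> V" for v
  proof (cases "v \<in> P 0")
    case True
    then show ?thesis
      using join_degree_left[OF G J True] reg card lower \<delta>_less by (simp add: regular_def)
  next
    case False
    then have "v \<in> P 1" using that J by (auto simp: join_partition_def)
    then show ?thesis using join_degree_right[OF G J] card by simp
  qed
  moreover have "V \<noteq> {}" using V n_pos by auto
  ultimately show ?thesis
    using regular_min_degree sgraph_finite[OF G] by metis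
qed

lemma eq_gfun_iff:
  "real k = gfun 3 \<beta> * real n ^ 3 \<longleftrightarrow> 2 * k = (n - \<delta>) * (2 * \<delta> - n) * \<delta>"
proof -
  have "real k = gfun 3 \<beta> * real n ^ 3 \<longleftrightarrow> real (2 * k) = real ((n - \<delta>) * (2 * \<delta> - n) * \<delta>)"
    unfolding gfun_n by auto
  then show ?thesis unfolding of_nat_eq_iff .
qed

lemma kmin_ge: "(n - \<delta>) * (2 * \<delta> - n) * \<delta> \<le> 2 * kmin 3 n \<delta>"
  using kmin_attained[OF \<delta>_less] kcl3_lower by metis

text \<open>If the bound is attained, a minimiser contains the triangle-free regular graph that
  feasibility asks for. If the pair is feasible, any member of the family bounds \<open>kmin\<close>
  from above.\<close>

lemma kmin_eq_iff: "2 * kmin 3 n \<delta> = (n - \<delta>) * (2 * \<delta> - n) * \<delta> \<longleftrightarrow> feasible n \<beta>"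
proof
  assume "2 * kmin 3 n \<delta> = (n - \<delta>) * (2 * \<delta> - n) * \<delta>"
  then show "feasible n \<beta>"
    using kmin_attained[OF \<delta>_less] extremal_feasible by metis
next
  assume feas: "feasible n \<beta>"
  then obtain V :: "nat set" and E P where P: "family_partition V E n \<beta> P"
    using family_nonempty feasible_iff by metis
  then have fam: "in_family V E n \<beta>" by (auto simp: in_family_def)
  have "sgraph V E" "card V = n" using P unfolding family_partition_iff by blast+
  then have "kmin 3 n \<delta> \<le> kcl 3 V E"
    using kmin_le in_family_min_degree[OF fam] by metis
  then show "2 * kmin 3 n \<delta> = (n - \<delta>) * (2 * \<delta> - n) * \<delta>"
    using in_family_count[OF feas fam] kmin_ge by linarith
qed

end

theorem mainTheorem1:
  fixes n \<delta> :: nat and \<beta> :: real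
  assumes "0 < n" and "0 < \<delta>"
    and "real n / 2 < real \<delta>" and "real \<delta> \<le> 2 * real n / 3"
    and "\<beta> = 1 - real \<delta> / real n"
  shows "gfun 3 \<beta> = 1 / 2 * (1 - 2 * \<beta>) * (1 - \<beta>) * \<beta>
    \<and> real (kmin 3 n \<delta>) \<ge> gfun 3 \<beta> * real n ^ 3
    \<and> (real (kmin 3 n \<delta>) = gfun 3 \<beta> * real n ^ 3 \<longleftrightarrow> feasible n \<beta>)
    \<and> (feasible n \<beta> \<longrightarrow>
        (\<forall>(V :: 'a set) E. sgraph V E \<and> card V = n \<and> min_degree V E = \<delta> \<longrightarrow>
           (real (kcl 3 V E) = gfun 3 \<beta> * real n ^ 3 \<longleftrightarrow> in_family V E n \<beta>)))"
proof -
  interpret density n \<delta> \<beta>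
    using assms by unfold_locales auto
  have "gfun 3 \<beta> * real n ^ 3 \<le> real (kmin 3 n \<delta>)"
  proof -
    have "real ((n - \<delta>) * (2 * \<delta> - n) * \<delta>) \<le> real (2 * kmin 3 n \<delta>)"
      using kmin_ge of_nat_le_iff by blast
    then show ?thesis unfolding gfun_n by simp
  qed
  then show ?thesis
    unfolding eq_gfun_iff kmin_eq_iff
    using gfun_3 in_family_count extremal_in_family by blast
qed

end
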